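(* Let $K$ be a field, $S=K[x_1,\dots,x_n]$ with $\mathfrak{m}=(x_1,\dots,x_n)$, and let $I\subset S$ be a componentwise polymatroidal ideal. Then the saturation $I^{\mathrm{sat}}=\bigcup_{k\ge0}(I:\mathfrak{m}^k)$ is componentwise polymatroidal.
   Context: For a monomial ideal $J$, $\mathcal{G}(J)$ denotes its minimal set of monomial generators, and $\deg_{x_i}(u)$ is the exponent of $x_i$ in the monomial $u$. A nonzero monomial ideal $J$ is polymatroidal if all elements of $\mathcal{G}(J)$ have the same degree and: for all $u,v\in\mathcal{G}(J)$ and all $i$ with $\deg_{x_i}(u)>\deg_{x_i}(v)$, there is $j$ with $\deg_{x_j}(u)<\deg_{x_j}(v)$ such that $x_j(u/x_i)\in\mathcal{G}(J)$. For a homogeneous ideal $I$ and $j\ge0$, $I_{\langle j\rangle}$ is the ideal generated by the degree $j$ component $I_j$ of $I$. A monomial ideal $I$ is componentwise polymatroidal if for every $j$ the ideal $I_{\langle j\rangle}$ is polymatroidal or zero. *)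

theory Defs
  imports Complex_Main "HOL-Library.Poly_Mapping"
begin

(* K[x_i : i in 'n] for a finite index type 'n: a monomial is identified with its exponent
   vector, a polynomial is a finitely supported function from exponent vectors to K. *)
type_synonym 'n monom = "'n \<Rightarrow>\<^sub>0 nat"
type_synonym ('n, 'k) mpoly = "'n monom \<Rightarrow>\<^sub>0 'k"

(* Ideals are the submodules of the ring over itself: ideal.subspace is "being an ideal",
   ideal.span is "ideal generated by". *)
interpretation ideal: module "(*) :: 'a::comm_ring_1 \<Rightarrow> 'a \<Rightarrow> 'a"
  by unfold_locales (auto simp: algebra_simps)

definition mono_poly :: "'n monom \<Rightarrow> ('n, 'k::field) mpoly" where
  "mono_poly u = Poly_Mapping.single u 1"

definition var :: "'n \<Rightarrow> 'n monom" where
  "var i = Poly_Mapping.single i 1"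

definition deg_in :: "'n \<Rightarrow> 'n monom \<Rightarrow> nat" where
  "deg_in i u = Poly_Mapping.lookup u i"

definition total_deg :: "'n::finite monom \<Rightarrow> nat" where
  "total_deg u = (\<Sum>i\<in>UNIV. deg_in i u)"

definition monomial_ideal :: "('n, 'k::field) mpoly set \<Rightarrow> bool" where
  "monomial_ideal J \<longleftrightarrow> (\<exists>A. J = ideal.span (mono_poly ` A))"

definition is_min_gens :: "('n, 'k::field) mpoly set \<Rightarrow> 'n monom set \<Rightarrow> bool" where
  "is_min_gens J G \<longleftrightarrow> ideal.span (mono_poly ` G) = J \<and>
     (\<forall>H. H \<subset> G \<longrightarrow> ideal.span (mono_poly ` H) \<noteq> J)"

(* Only meaningful for monomial ideals; well-defined there by ex1_min_gens below. *)
definition min_gens :: "('n, 'k::field) mpoly set \<Rightarrow> 'n monom set" where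
  "min_gens J = (THE G. is_min_gens J G)"

(* The subtraction u - var i is the exact quotient u / x_i, since deg_in i u > 0. *)
definition polymatroidal :: "('n::finite, 'k::field) mpoly set \<Rightarrow> bool" where
  "polymatroidal J \<longleftrightarrow> monomial_ideal J \<and> J \<noteq> {0} \<and>
     (\<forall>u\<in>min_gens J. \<forall>v\<in>min_gens J. total_deg u = total_deg v) \<and>
     (\<forall>u\<in>min_gens J. \<forall>v\<in>min_gens J. \<forall>i. deg_in i u > deg_in i v \<longrightarrow>
        (\<exists>j. deg_in j u < deg_in j v \<and> var j + (u - var i) \<in> min_gens J))"

definition homogeneous_of_deg :: "nat \<Rightarrow> ('n::finite, 'k::field) mpoly \<Rightarrow> bool" where
  "homogeneous_of_deg d f \<longleftrightarrow> (\<forall>u\<in>Poly_Mapping.keys f. total_deg u = d)"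

definition component :: "('n::finite, 'k::field) mpoly set \<Rightarrow> nat \<Rightarrow> ('n, 'k) mpoly set" where
  "component I d = {f \<in> I. homogeneous_of_deg d f}"

definition component_ideal :: "('n::finite, 'k::field) mpoly set \<Rightarrow> nat \<Rightarrow> ('n, 'k) mpoly set" where
  "component_ideal I d = ideal.span (component I d)"

definition componentwise_polymatroidal :: "('n::finite, 'k::field) mpoly set \<Rightarrow> bool" where
  "componentwise_polymatroidal I \<longleftrightarrow> monomial_ideal I \<and>
     (\<forall>d. polymatroidal (component_ideal I d) \<or> component_ideal I d = {0})"

definition irrelevant_ideal :: "('n::finite, 'k::field) mpoly set" where
  "irrelevant_ideal = ideal.span (range (\<lambda>i. mono_poly (var i)))"

definition ideal_prod :: "'a::comm_ring_1 set \<Rightarrow> 'a set \<Rightarrow> 'a set" where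
  "ideal_prod I J = ideal.span {a * b | a b. a \<in> I \<and> b \<in> J}"

primrec ideal_pow :: "'a::comm_ring_1 set \<Rightarrow> nat \<Rightarrow> 'a set" where
  "ideal_pow I 0 = UNIV"
| "ideal_pow I (Suc k) = ideal_prod I (ideal_pow I k)"

definition colon_ideal :: "'a::comm_ring_1 set \<Rightarrow> 'a set \<Rightarrow> 'a set" where
  "colon_ideal I J = {f. \<forall>g\<in>J. f * g \<in> I}"

definition saturation :: "('n::finite, 'k::field) mpoly set \<Rightarrow> ('n, 'k) mpoly set" where
  "saturation I = (\<Union>k. colon_ideal I (ideal_pow irrelevant_ideal k))"


lemma mono_poly_add: "mono_poly (u + v) = mono_poly u * mono_poly v"
  by (simp add: mono_poly_def mult_single)

lemma keys_span_mono_poly: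
  fixes f :: "('n, 'k::field) mpoly"
  assumes "f \<in> ideal.span (mono_poly ` A)" "u \<in> Poly_Mapping.keys f"
  shows "\<exists>v\<in>A. \<exists>w. u = v + w"
proof -
  let ?S = "{f :: ('n, 'k) mpoly. \<forall>u\<in>Poly_Mapping.keys f. \<exists>v\<in>A. \<exists>w. u = v + w}"
  have "ideal.subspace ?S"
  proof (rule ideal.subspaceI)
    show "x + y \<in> ?S" if "x \<in> ?S" "y \<in> ?S" for x y :: "('n, 'k) mpoly"
      using that Poly_Mapping.keys_add[of x y] by blast
    show "c * x \<in> ?S" if "x \<in> ?S" for c x :: "('n, 'k) mpoly"
    proof (clarify)
      fix u assume "u \<in> Poly_Mapping.keys (c * x)"
      with keys_mult[of c x] obtain a b where u: "u = a + b" and b: "b \<in> Poly_Mapping.keys x"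
        by blast
      from b that obtain v w where "v \<in> A" "b = v + w" by blast
      with u have "u = v + (a + w)" by (simp add: algebra_simps)
      with \<open>v \<in> A\<close> show "\<exists>v\<in>A. \<exists>w. u = v + w" by blast
    qed
  qed simp
  moreover have "mono_poly ` A \<subseteq> ?S"
  proof (clarsimp simp: mono_poly_def)
    show "\<exists>v\<in>A. \<exists>w. u = v + w" if "u \<in> A" for u
      using that by (intro bexI[of _ u] exI[of _ 0]) auto
  qed
  ultimately have "ideal.span (mono_poly ` A) \<subseteq> ?S"
    by (rule ideal.span_minimal[rotated])
  with assms show ?thesis by blast
qed

lemma mono_poly_in_span_iff:
  "mono_poly u \<in> ideal.span (mono_poly ` A) \<longleftrightarrow> (\<exists>v\<in>A. \<exists>w. u = v + w)"
proof
  assume "mono_poly u \<in> ideal.span (mono_poly ` A)"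
  then show "\<exists>v\<in>A. \<exists>w. u = v + w"
    by (rule keys_span_mono_poly) (simp add: mono_poly_def)
next
  assume "\<exists>v\<in>A. \<exists>w. u = v + w"
  then obtain v w where "v \<in> A" "u = w + v" by (auto simp: add.commute)
  then show "mono_poly u \<in> ideal.span (mono_poly ` A)"
    by (simp add: mono_poly_add ideal.span_scale ideal.span_base)
qed

lemma total_deg_add: "total_deg (u + v) = total_deg u + total_deg v"
  by (simp add: total_deg_def deg_in_def lookup_add sum.distrib)

lemma total_deg_eq_0_iff: "total_deg u = 0 \<longleftrightarrow> u = 0"
  by (auto simp: total_deg_def deg_in_def intro: poly_mapping_eqI)

definition divisor_minimal :: "('n, 'k::field) mpoly set \<Rightarrow> 'n monom set" where
  "divisor_minimal J =
     {u. mono_poly u \<in> J \<and> (\<forall>v w. u = v + w \<and> mono_poly v \<in> J \<longrightarrow> w = 0)}"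

lemma divisor_minimal_below:
  fixes J :: "('n::finite, 'k::field) mpoly set"
  assumes "mono_poly u \<in> J"
  shows "\<exists>v\<in>divisor_minimal J. \<exists>w. u = v + w"
  using assms
proof (induction "total_deg u" arbitrary: u rule: less_induct)
  case less
  show ?case
  proof (cases "u \<in> divisor_minimal J")
    case True
    then show ?thesis by (intro bexI[of _ u] exI[of _ 0]) auto
  next
    case False
    with less.prems obtain v w where vw: "u = v + w" "mono_poly v \<in> J" "w \<noteq> 0"
      by (auto simp: divisor_minimal_def)
    then have "total_deg v < total_deg u"
      using total_deg_eq_0_iff[of w] by (simp add: total_deg_add)
    from less.hyps[OF this vw(2)] obtain v' w' where "v' \<in> divisor_minimal J" "v = v' + w'"
      by blast
    then show ?thesis using vw(1) by (metis add.assoc)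
  qed
qed

lemma divisor_minimal_subset:
  fixes J :: "('n, 'k::field) mpoly set"
  assumes "ideal.span (mono_poly ` A) = J"
  shows "divisor_minimal J \<subseteq> A"
proof
  fix u assume u: "u \<in> divisor_minimal J"
  then have "(mono_poly u :: ('n, 'k) mpoly) \<in> ideal.span (mono_poly ` A)"
    unfolding assms by (simp add: divisor_minimal_def)
  then obtain v w where vw: "v \<in> A" "u = v + w" by (auto simp: mono_poly_in_span_iff)
  then have "mono_poly v \<in> J" using assms by (auto intro: ideal.span_base)
  with u vw have "w = 0" by (auto simp: divisor_minimal_def)
  with vw show "u \<in> A" by simp
qed

lemma span_divisor_minimal:
  fixes J :: "('n::finite, 'k::field) mpoly set"
  assumes "monomial_ideal J"
  shows "ideal.span (mono_poly ` divisor_minimal J) = J"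
proof -
  from assms obtain A where A: "J = ideal.span (mono_poly ` A)"
    by (auto simp: monomial_ideal_def)
  have "mono_poly ` A \<subseteq> ideal.span (mono_poly ` divisor_minimal J)"
  proof (clarsimp simp: mono_poly_in_span_iff)
    show "\<exists>v\<in>divisor_minimal J. \<exists>w. u = v + w" if "u \<in> A" for u
      using that by (intro divisor_minimal_below) (simp add: A ideal.span_base)
  qed
  then have "J \<subseteq> ideal.span (mono_poly ` divisor_minimal J)"
    using A ideal.span_minimal[OF _ ideal.subspace_span] by blast
  moreover have "ideal.span (mono_poly ` divisor_minimal J) \<subseteq> J"
    by (rule ideal.span_minimal) (auto simp: divisor_minimal_def A)
  ultimately show ?thesis by blast
qed

lemma is_min_gens_iff:
  fixes J :: "('n::finite, 'k::field) mpoly set"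
  assumes "monomial_ideal J"
  shows "is_min_gens J G \<longleftrightarrow> G = divisor_minimal J"
  using span_divisor_minimal[OF assms] divisor_minimal_subset[of _ J]
  unfolding is_min_gens_def by blast

lemma ex1_min_gens:
  fixes J :: "('n::finite, 'k::field) mpoly set"
  assumes "monomial_ideal J"
  shows "\<exists>!G. is_min_gens J G"
  using is_min_gens_iff[OF assms] by blast

lemma min_gens_eq:
  fixes J :: "('n::finite, 'k::field) mpoly set"
  assumes "monomial_ideal J"
  shows "min_gens J = divisor_minimal J"
  unfolding min_gens_def is_min_gens_iff[OF assms] by simp

end

theory Submission
  imports Defs
begin

text \<open>
  Everything is read off the set \<open>U\<close> of exponent vectors of the monomials of \<open>I\<close>: it is closed
  under addition of arbitrary vectors and its degree layers have the exchange property. Allowing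
  arbitrary powers of one variable \<open>x\<^sub>k\<close> (that is, passing to \<open>I : x\<^sub>k\<^sup>\<infinity>\<close>) yields an exchange
  property between vectors of different degrees, and \<open>I\<^sup>s\<^sup>a\<^sup>t\<close> is the intersection of these colon
  ideals.

  Call \<open>B\<close> tight for \<open>u\<close> if \<open>u(B) \<le> x(B)\<close> for all \<open>x \<in> U\<close>. If \<open>u\<close> is in the saturation but
  \<open>x\<^sub>j u / x\<^sub>i\<close> is not, then some tight set contains \<open>i\<close> but not \<open>j\<close>. A greedy argument shows that
  \<open>B \<inter> C\<close> is tight whenever \<open>B\<close> and \<open>C\<close> are and \<open>B \<union> C\<close> is not everything. Hence, if no exchange of
  \<open>i\<close> towards \<open>v\<close> were possible, the complements of smallest separating tight sets would be
  pairwise disjoint or equal and would cover all \<open>j\<close> with \<open>u\<^sub>j < v\<^sub>j\<close>. On each of them \<open>u\<close> weighs at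
  least as much as \<open>v\<close>, and elsewhere too, strictly at \<open>i\<close>, so \<open>u\<close> and \<open>v\<close> could not have the
  same degree.
\<close>

section \<open>Exponent sets\<close>

abbreviation deg_on :: "'n set \<Rightarrow> 'n monom \<Rightarrow> nat" where
  "deg_on B u \<equiv> \<Sum>b\<in>B. deg_in b u"

lemma deg_in_simps [simp]:
  "deg_in b 0 = 0"
  "deg_in b (u + v) = deg_in b u + deg_in b v"
  "deg_in b (u - v) = deg_in b u - deg_in b v"
  "deg_in b (var i) = (if b = i then 1 else 0)"
  "deg_in b (Poly_Mapping.single i N) = (if b = i then N else 0)"
  by (simp_all add: deg_in_def var_def lookup_add lookup_minus lookup_single when_def)

lemma monom_eqI: "(\<And>b. deg_in b u = deg_in b v) \<Longrightarrow> u = v"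
  by (simp add: deg_in_def poly_mapping_eqI)

text \<open>For the exponent set of a monomial ideal, the degree \<open>d\<close> layer consists of
  the minimal generators of the ideal spanned by the degree \<open>d\<close> component, so the
  axioms encode componentwise polymatroidality. An empty layer is a zero component.\<close>

locale layered =
  fixes U :: "'n::finite monom set"
  assumes up: "u \<in> U \<Longrightarrow> u + w \<in> U"
    and exchange: "\<lbrakk>u \<in> U; v \<in> U; total_deg u = total_deg v; deg_in i v < deg_in i u\<rbrakk> \<Longrightarrow>
      \<exists>j. deg_in j u < deg_in j v \<and> var j + (u - var i) \<in> U"
begin

text \<open>If \<open>U\<close> is the set of exponents of \<open>I\<close>, then \<open>loc k\<close> is that of \<open>I : x\<^sub>k\<^sup>\<infinity>\<close>.\<close>

definition loc :: "'n \<Rightarrow> 'n monom set" where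
  "loc k = {x. \<exists>N. x + Poly_Mapping.single k N \<in> U}"

definition sat :: "'n monom set" where
  "sat = (\<Inter>k. loc k)"

definition tight :: "'n monom \<Rightarrow> 'n set \<Rightarrow> bool" where
  "tight u B \<longleftrightarrow> (\<forall>x\<in>U. deg_on B u \<le> deg_on B x)"

section \<open>Exchange in the colon ideals by powers of one variable\<close>

lemma loc_up: "x \<in> loc k \<Longrightarrow> x + w \<in> loc k"
  unfolding loc_def using up[of "x + Poly_Mapping.single k _" w]
  by (auto simp: ac_simps)

lemma subset_loc: "U \<subseteq> loc k"
  unfolding loc_def using up by blast

lemma loc_single: "x + Poly_Mapping.single k N \<in> loc k \<Longrightarrow> x \<in> loc k"
  unfolding loc_def by (auto simp: add.assoc simp flip: single_add)

text \<open>Large powers of \<open>x_k\<close> move both vectors into \<open>U\<close> with equal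
  degrees, where \<open>exchange\<close> applies. If the new index is \<open>k\<close>, it can be
  cancelled in \<open>loc k\<close>, which leaves the case where \<open>i\<close> is simply
  dropped.\<close>

lemma loc_exchange:
  assumes "x \<in> loc k" "y \<in> loc k" "i \<noteq> k" and lt: "deg_in i y < deg_in i x"
  shows "x - var i \<in> loc k \<or> (\<exists>j. j \<noteq> k \<and> deg_in j x < deg_in j y \<and> var j + (x - var i) \<in> loc k)"
proof -
  obtain M N where M: "x + Poly_Mapping.single k M \<in> U" and N: "y + Poly_Mapping.single k N \<in> U"
    using assms by (auto simp: loc_def)
  \<comment> \<open>The exponents are at least \<open>M\<close> and \<open>N\<close>, and both total
    degrees become \<open>M + N + total_deg x + total_deg y\<close>.\<close>
  define x' where "x' = x + Poly_Mapping.single k (M + (N + total_deg y))"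
  define y' where "y' = y + Poly_Mapping.single k (N + (M + total_deg x))"
  have x': "x' \<in> U" and y': "y' \<in> U"
    unfolding x'_def y'_def single_add using up[OF M] up[OF N] by (metis add.assoc)+
  have "total_deg (Poly_Mapping.single k m) = m" for m
    by (simp add: total_deg_def)
  then have "total_deg x' = total_deg y'"
    by (simp add: x'_def y'_def total_deg_add)
  moreover have "deg_in i y' < deg_in i x'"
    using lt \<open>i \<noteq> k\<close> by (simp add: x'_def y'_def)
  ultimately obtain j where j: "deg_in j x' < deg_in j y'" "var j + (x' - var i) \<in> U"
    using exchange[OF x' y'] by blast
  let ?s = "Poly_Mapping.single k (M + (N + total_deg y))"
  have eq: "var j + (x' - var i) = (var j + (x - var i)) + ?s"
    using lt \<open>i \<noteq> k\<close> by (intro monom_eqI) (auto simp: x'_def)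
  have in_loc: "var j + (x - var i) \<in> loc k"
    using j(2) unfolding eq loc_def by blast
  show ?thesis
  proof (cases "j = k")
    case True
    then show ?thesis
      using in_loc loc_single[of "x - var i" k 1] by (simp add: var_def add.commute)
  next
    case False
    then show ?thesis using j(1) in_loc by (auto simp: x'_def y'_def)
  qed
qed

section \<open>Weights on subsets and tight sets\<close>

lemma tight_loc:
  assumes "tight u B" "k \<notin> B" "x \<in> loc k"
  shows "deg_on B u \<le> deg_on B x"
proof -
  obtain N where "x + Poly_Mapping.single k N \<in> U" using assms by (auto simp: loc_def)
  then have "deg_on B u \<le> deg_on B (x + Poly_Mapping.single k N)"
    using assms by (auto simp: tight_def)
  also have "\<dots> = deg_on B x"
    using assms by (intro sum.cong) auto
  finally show ?thesis .
qed

text \<open>The unit lost at \<open>i\<close> is put on the left to avoid truncated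
  subtraction.\<close>

lemma deg_on_exchange:
  fixes x :: "'n monom"
  assumes "0 < deg_in i x"
  shows "deg_on B (var j + (x - var i)) + (if i \<in> B then 1 else 0) = deg_on B x + (if j \<in> B then 1 else 0)"
proof -
  have "deg_on B (var j + (x - var i) + var i) = deg_on B (x + var j)"
    using assms by (intro sum.cong) auto
  then show ?thesis by (simp add: sum.distrib)
qed

text \<open>Greedy principle for a nested pair: minimising on \<open>B\<close> first costs nothing
  on \<open>C\<close>, since otherwise an exchange towards a minimiser on \<open>C\<close> would
  keep both weights and come closer to it.\<close>

lemma simultaneous_minimum:
  assumes "C \<subseteq> B" "k \<notin> B" "loc k \<noteq> {}"
  obtains w where "w \<in> loc k" "\<And>x. x \<in> loc k \<Longrightarrow> deg_on B w \<le> deg_on B x"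
    "\<And>x. x \<in> loc k \<Longrightarrow> deg_on C w \<le> deg_on C x"
proof -
  define P where "P w \<longleftrightarrow> w \<in> loc k \<and> (\<forall>x\<in>loc k. deg_on B w \<le> deg_on B x)" for w
  define Q where "Q w \<longleftrightarrow> P w \<and> (\<forall>x. P x \<longrightarrow> deg_on C w \<le> deg_on C x)" for w
  obtain p where p: "P p"
    using assms(3) ex_has_least_nat[of "\<lambda>x. x \<in> loc k" _ "deg_on B"] unfolding P_def by blast
  obtain q where q: "Q q"
    using p ex_has_least_nat[of P _ "deg_on C"] unfolding Q_def by blast
  obtain y where y: "y \<in> loc k" "\<And>x. x \<in> loc k \<Longrightarrow> deg_on C y \<le> deg_on C x"
    using assms(3) ex_has_least_nat[of "\<lambda>x. x \<in> loc k" _ "deg_on C"] by blast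
  \<comment> \<open>Among the minimisers on \<open>B\<close>, and then on \<open>C\<close>, one closest on \<open>C\<close> to a global minimiser on \<open>C\<close>.\<close>
  let ?D = "\<lambda>w. \<Sum>c\<in>C. deg_in c w - deg_in c y"
  obtain w where w: "Q w" "\<And>x. Q x \<Longrightarrow> ?D w \<le> ?D x"
    using q ex_has_least_nat[of Q _ ?D] by blast
  have Pw: "P w" and w_loc: "w \<in> loc k" and w_B: "\<And>x. x \<in> loc k \<Longrightarrow> deg_on B w \<le> deg_on B x"
    and w_C: "\<And>x. P x \<Longrightarrow> deg_on C w \<le> deg_on C x"
    using w(1) by (auto simp: P_def Q_def)
  have "deg_on C w \<le> deg_on C y"
  proof (rule ccontr)
    assume "\<not> ?thesis"
    then obtain i where i: "i \<in> C" "deg_in i y < deg_in i w"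
      by (metis linorder_not_le sum_mono)
    then have "i \<in> B" "i \<noteq> k" "0 < deg_in i w" using assms by auto
    have "w - var i \<notin> loc k"
    proof
      assume "w - var i \<in> loc k"
      then have "deg_on B w \<le> deg_on B (w - var i)" by (rule w_B)
      moreover have "deg_on B (w - var i) < deg_on B w"
        using \<open>i \<in> B\<close> \<open>0 < deg_in i w\<close> by (intro sum_strict_mono_ex1) auto
      ultimately show False by simp
    qed
    with loc_exchange[OF w_loc y(1) \<open>i \<noteq> k\<close> i(2)] obtain j
      where j: "deg_in j w < deg_in j y" "var j + (w - var i) \<in> loc k" by blast
    let ?x = "var j + (w - var i)"
    have B: "deg_on B ?x + 1 = deg_on B w + (if j \<in> B then 1 else 0)"
      using deg_on_exchange[OF \<open>0 < deg_in i w\<close>, where B = B and j = j] \<open>i \<in> B\<close> by simp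
    \<comment> \<open>Minimality of \<open>w\<close> on \<open>B\<close> forces \<open>j\<close>
      into \<open>B\<close>; minimality on \<open>C\<close> then forces \<open>j\<close> into
      \<open>C\<close>.\<close>
    with w_B[OF j(2)] have Bx: "deg_on B ?x = deg_on B w"
      by (auto split: if_splits)
    then have Px: "P ?x" using j(2) w_B by (simp add: P_def)
    have C: "deg_on C ?x + 1 = deg_on C w + (if j \<in> C then 1 else 0)"
      using deg_on_exchange[OF \<open>0 < deg_in i w\<close>, where B = C and j = j] \<open>i \<in> C\<close> by simp
    with w_C[OF Px] have "deg_on C ?x = deg_on C w"
      by (auto split: if_splits)
    then have "Q ?x" using Px w_C by (simp add: Q_def)
    then have "?D w \<le> ?D ?x" by (rule w(2))
    \<comment> \<open>Only the excess over \<open>y\<close> counts: it falls at \<open>i\<close> and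
      stays 0 at \<open>j\<close>, where \<open>w\<close> was strictly below
      \<open>y\<close>.\<close>
    moreover have "?D ?x < ?D w"
      using i j(1) by (intro sum_strict_mono_ex1) (auto intro!: bexI[of _ i])
    ultimately show False by simp
  qed
  with y(2) have "\<And>x. x \<in> loc k \<Longrightarrow> deg_on C w \<le> deg_on C x"
    using le_trans by blast
  with w_loc w_B show thesis by (rule that)
qed

text \<open>Choose \<open>k\<close> outside \<open>B \<union> C\<close> and compare \<open>u\<close>
  with a \<open>w\<close> that is minimal in \<open>loc k\<close> on both union and intersection.
  Weights on \<open>B\<close> and \<open>C\<close> add up to those on union and intersection;
  \<open>w\<close> is no lighter than \<open>u\<close> on \<open>B\<close> and \<open>C\<close> and
  no heavier on the union, hence no lighter on the intersection.\<close>

lemma tight_Int: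
  assumes u: "u \<in> sat" and B: "tight u B" and C: "tight u C" and "B \<union> C \<noteq> UNIV"
  shows "tight u (B \<inter> C)"
proof -
  obtain k where k: "k \<notin> B \<union> C" using assms(4) by blast
  have u_loc: "u \<in> loc k" using u by (auto simp: sat_def)
  obtain w where w: "w \<in> loc k" "\<And>x. x \<in> loc k \<Longrightarrow> deg_on (B \<union> C) w \<le> deg_on (B \<union> C) x"
    "\<And>x. x \<in> loc k \<Longrightarrow> deg_on (B \<inter> C) w \<le> deg_on (B \<inter> C) x"
    using simultaneous_minimum[of "B \<inter> C" "B \<union> C" k] k u_loc by blast
  have "deg_on B u \<le> deg_on B w" "deg_on C u \<le> deg_on C w"
    using tight_loc[OF B _ w(1)] tight_loc[OF C _ w(1)] k by auto
  moreover have "deg_on (B \<union> C) u + deg_on (B \<inter> C) u = deg_on B u + deg_on C u"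
    "deg_on (B \<union> C) w + deg_on (B \<inter> C) w = deg_on B w + deg_on C w"
    by (simp_all add: sum.union_inter)
  moreover have "deg_on (B \<union> C) w \<le> deg_on (B \<union> C) u" using u_loc by (rule w(2))
  ultimately have "deg_on (B \<inter> C) u \<le> deg_on (B \<inter> C) w" by linarith
  then show ?thesis
    unfolding tight_def using w(3) subset_loc le_trans by blast
qed

text \<open>Local minimality suffices: a point of smaller weight on \<open>B\<close> that is closest to \<open>u\<close> cannot exceed
  \<open>u\<close> anywhere in \<open>B\<close>, so exchanging from \<open>u\<close> towards it leads out of \<open>B\<close>.\<close>

lemma local_minimum_tight:
  assumes u: "u \<in> loc k" and k: "k \<notin> B"
    and no_drop: "\<And>b. b \<in> B \<Longrightarrow> 0 < deg_in b u \<Longrightarrow> u - var b \<notin> loc k"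
    and no_leave: "\<And>b c. \<lbrakk>b \<in> B; 0 < deg_in b u; c \<noteq> k; var c + (u - var b) \<in> loc k\<rbrakk> \<Longrightarrow> c \<in> B"
  shows "tight u B"
proof (rule ccontr)
  define P where "P x \<longleftrightarrow> x \<in> loc k \<and> deg_on B x < deg_on B u" for x
  \<comment> \<open>The distance to \<open>u\<close> off \<open>k\<close>; two truncated differences
    make up each absolute value.\<close>
  let ?D = "\<lambda>x. \<Sum>c\<in>UNIV - {k}. (deg_in c x - deg_in c u) + (deg_in c u - deg_in c x)"
  assume "\<not> tight u B"
  then obtain x0 where "P x0" using subset_loc by (auto simp: tight_def P_def not_le)
  then obtain x where x: "P x" "\<And>y. P y \<Longrightarrow> ?D x \<le> ?D y"
    using ex_has_least_nat[of P _ ?D] by blast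
  then have x_loc: "x \<in> loc k" and x_B: "deg_on B x < deg_on B u" by (auto simp: P_def)
  have below: "deg_in c x \<le> deg_in c u" if c: "c \<in> B" for c
  proof (rule ccontr)
    assume "\<not> ?thesis"
    then have lt: "deg_in c u < deg_in c x" by simp
    have "c \<noteq> k" using c k by blast
    have closer: False if y: "y \<in> loc k" "deg_on B y \<le> deg_on B x" "?D y < ?D x" for y
      using x(2)[of y] y x_B by (auto simp: P_def)
    from loc_exchange[OF x_loc u \<open>c \<noteq> k\<close> lt] show False
    proof (elim disjE exE conjE)
      assume "x - var c \<in> loc k"
      then show False
      proof (rule closer)
        show "deg_on B (x - var c) \<le> deg_on B x" by (intro sum_mono) auto
        show "?D (x - var c) < ?D x"
          using lt \<open>c \<noteq> k\<close> by (intro sum_strict_mono_ex1) (auto intro!: bexI[of _ c])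
      qed
    next
      fix j assume j: "j \<noteq> k" "deg_in j x < deg_in j u" "var j + (x - var c) \<in> loc k"
      from j(3) show False
      proof (rule closer)
        show "deg_on B (var j + (x - var c)) \<le> deg_on B x"
          using deg_on_exchange[of c x j B] lt c by (auto split: if_splits)
        show "?D (var j + (x - var c)) < ?D x"
          using lt j \<open>c \<noteq> k\<close> by (intro sum_strict_mono_ex1) (auto intro!: bexI[of _ c])
      qed
    qed
  qed
  from x_B obtain b where b: "b \<in> B" "deg_in b x < deg_in b u"
    by (metis linorder_not_le sum_mono)
  then have "b \<noteq> k" "0 < deg_in b u" using k by auto
  with loc_exchange[OF u x_loc \<open>b \<noteq> k\<close> b(2)] no_drop[OF b(1)] obtain c
    where "c \<noteq> k" "deg_in c u < deg_in c x" "var c + (u - var b) \<in> loc k" by blast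
  with no_leave[OF b(1) \<open>0 < deg_in b u\<close>] below show False by fastforce
qed

text \<open>If \<open>s + (u - var b)\<close> were in \<open>loc k\<close>, exchange it at
  \<open>i\<close> towards \<open>var b + (u - var i)\<close>: only \<open>b\<close> can come in,
  and the result is \<open>s + (u - var i)\<close>. It is applied with \<open>s\<close> equal to 0
  or to one variable.\<close>

lemma dependence_trans:
  assumes "i \<noteq> k" "0 < deg_in i u" "0 < deg_in b u"
    and x: "var b + (u - var i) \<in> loc k" and z: "s + (u - var i) \<notin> loc k"
  shows "s + (u - var b) \<notin> loc k"
proof (cases "b = i")
  case False
  show ?thesis
  proof
    let ?y = "s + (u - var b)"
    assume y: "?y \<in> loc k"
    have eq: "var b + (?y - var i) = s + (u - var i)"
      using assms False by (intro monom_eqI) auto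
    have "deg_in i (var b + (u - var i)) < deg_in i ?y"
      using assms False by auto
    from loc_exchange[OF y x \<open>i \<noteq> k\<close> this] show False
    proof (elim disjE exE conjE)
      assume "?y - var i \<in> loc k"
      then show False using loc_up[of "?y - var i" k "var b"] eq z by (simp add: add.commute)
    next
      fix j assume j: "deg_in j ?y < deg_in j (var b + (u - var i))" "var j + (?y - var i) \<in> loc k"
      then have "j = b" by (auto split: if_splits)
      with j(2) eq z show False by simp
    qed
  qed
qed (use z in simp)

text \<open>Some \<open>loc k\<close> omits the exchanged vector. The separating set is the analogue
  of a fundamental circuit: all \<open>b\<close> that can replace \<open>i\<close> in
  \<open>u\<close> within \<open>loc k\<close>. By \<open>dependence_trans\<close> no exchange
  leaves it, so \<open>u\<close> is a local minimum on it.\<close>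

lemma tight_separation:
  assumes u: "u \<in> sat" and i: "0 < deg_in i u" and z: "var j + (u - var i) \<notin> sat"
  obtains B where "i \<in> B" "j \<notin> B" "tight u B"
proof -
  obtain k where k: "var j + (u - var i) \<notin> loc k" using z by (auto simp: sat_def)
  have u_loc: "u \<in> loc k" using u by (auto simp: sat_def)
  have ui: "var i + (u - var i) = u" using i by (intro monom_eqI) auto
  have drop: "u - var i \<notin> loc k" using k loc_up[of "u - var i" k "var j"] by (auto simp: add.commute)
  then have "i \<noteq> k"
    using u_loc ui loc_single[of "u - var i" k 1] by (auto simp: var_def add.commute)
  define B where "B = {b. b \<noteq> k \<and> var b + (u - var i) \<in> loc k}"
  have "tight u B"
  proof (rule local_minimum_tight[OF u_loc])
    show "u - var b \<notin> loc k" if "b \<in> B" "0 < deg_in b u" for b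
      using dependence_trans[of i k u b 0] that drop i \<open>i \<noteq> k\<close> by (auto simp: B_def)
    show "c \<in> B" if "b \<in> B" "0 < deg_in b u" "c \<noteq> k" "var c + (u - var b) \<in> loc k" for b c
      using dependence_trans[of i k u b "var c"] that i \<open>i \<noteq> k\<close> by (auto simp: B_def)
  qed (simp add: B_def)
  moreover have "i \<in> B" "j \<notin> B" using \<open>i \<noteq> k\<close> ui u_loc k by (auto simp: B_def)
  ultimately show thesis using that by blast
qed

lemma sat_exchange:
  assumes u: "u \<in> sat" and v: "v \<in> sat" and deg: "total_deg u = total_deg v"
    and i: "deg_in i v < deg_in i u"
  shows "\<exists>j. deg_in j u < deg_in j v \<and> var j + (u - var i) \<in> sat"
proof (rule ccontr)
  assume contra: "\<not> ?thesis"
  define J where "J = {j. deg_in j u < deg_in j v}"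
  define sep where "sep j B \<longleftrightarrow> i \<in> B \<and> j \<notin> B \<and> tight u B" for j B
  have "\<exists>B. sep j B \<and> (\<forall>B'. sep j B' \<longrightarrow> card B \<le> card B')" if "j \<in> J" for j
  proof -
    have "var j + (u - var i) \<notin> sat" using contra that by (auto simp: J_def)
    then obtain B where "sep j B"
      using tight_separation[OF u] i unfolding sep_def by (metis gr_zeroI not_less_zero)
    then show ?thesis using ex_has_least_nat[of "sep j" B card] by blast
  qed
  then obtain S where S: "\<And>j. j \<in> J \<Longrightarrow> sep j (S j)"
    and S_min: "\<And>j B. j \<in> J \<Longrightarrow> sep j B \<Longrightarrow> card (S j) \<le> card B"
    by metis
  \<comment> \<open>The intersection is tight and separates \<open>i\<close> from both
    \<open>j\<close> and \<open>j'\<close>, so by minimal cardinality it equals both sets.\<close>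
  have S_eq: "S j = S j'" if j: "j \<in> J" "j' \<in> J" and "S j \<union> S j' \<noteq> UNIV" for j j'
  proof -
    have "tight u (S j \<inter> S j')"
      using tight_Int[OF u] S[OF j(1)] S[OF j(2)] that(3) by (auto simp: sep_def)
    then have "sep j (S j \<inter> S j')" "sep j' (S j \<inter> S j')"
      using S[OF j(1)] S[OF j(2)] by (auto simp: sep_def)
    then have "S j \<inter> S j' = S j" "S j \<inter> S j' = S j'"
      using S_min j by (meson card_seteq finite inf_le1 inf_le2)+
    then show ?thesis by blast
  qed
  let ?F = "(\<lambda>j. - S j) ` J"
  let ?T = "\<Union>?F"
  have disj: "\<forall>A\<in>?F. \<forall>B\<in>?F. A \<noteq> B \<longrightarrow> A \<inter> B = {}"
    using S_eq by fastforce
  have sum_T: "deg_on ?T x = (\<Sum>A\<in>?F. deg_on A x)" for x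
    using disj by (subst sum.Union_disjoint) auto
  have total: "total_deg x = deg_on B x + deg_on (- B) x" for x B
    unfolding total_deg_def by (simp add: Compl_eq_Diff_UNIV sum.subset_diff[of B UNIV])
  have "deg_on ?T v \<le> deg_on ?T u"
    unfolding sum_T
  proof (rule sum_mono)
    fix A assume "A \<in> ?F"
    then obtain j where j: "j \<in> J" "A = - S j" by blast
    \<comment> \<open>As \<open>j\<close> is outside \<open>S j\<close>, tightness also bounds
      \<open>v\<close>; equal total degrees reverse the inequality on the complement.\<close>
    have "v \<in> loc j" using v by (auto simp: sat_def)
    then have "deg_on (S j) u \<le> deg_on (S j) v"
      using S[OF j(1)] tight_loc by (auto simp: sep_def)
    then show "deg_on A v \<le> deg_on A u"
      using deg total[of u "S j"] total[of v "S j"] j by simp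
  qed
  \<comment> \<open>Each \<open>j\<close> in \<open>J\<close> lies in the complement of
    \<open>S j\<close>, while \<open>i\<close> lies in every \<open>S j\<close>.\<close>
  moreover have "deg_on (- ?T) v < deg_on (- ?T) u"
  proof (rule sum_strict_mono_ex1)
    show "\<forall>b\<in>- ?T. deg_in b v \<le> deg_in b u"
    proof
      fix b assume "b \<in> - ?T"
      then have "b \<notin> J" using S by (auto simp: sep_def)
      then show "deg_in b v \<le> deg_in b u" by (simp add: J_def)
    qed
    show "\<exists>b\<in>- ?T. deg_in b v < deg_in b u"
      using S i by (intro bexI[of _ i]) (auto simp: sep_def)
  qed simp
  ultimately show False using deg total[of u ?T] total[of v ?T] by linarith
qed

end

section \<open>Monomial ideals\<close>

definition monoms :: "('n, 'k::field) mpoly set \<Rightarrow> 'n monom set" where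
  "monoms I = {u. mono_poly u \<in> I}"

lemma keys_mono_poly [simp]: "Poly_Mapping.keys (mono_poly u :: ('n, 'k::field) mpoly) = {u}"
  by (simp add: mono_poly_def)

lemma eq_sum_single:
  "f = (\<Sum>u\<in>Poly_Mapping.keys f. Poly_Mapping.single u (Poly_Mapping.lookup f u))"
  by (rule poly_mapping_eqI) (simp add: lookup_sum lookup_single when_def in_keys_iff)

lemma in_subspace_if_keys:
  fixes f :: "('n, 'k::field) mpoly"
  assumes "ideal.subspace J" "\<And>u. u \<in> Poly_Mapping.keys f \<Longrightarrow> mono_poly u \<in> J"
  shows "f \<in> J"
proof -
  have "f = (\<Sum>u\<in>Poly_Mapping.keys f. Poly_Mapping.single u (Poly_Mapping.lookup f u))"
    by (rule eq_sum_single)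
  also have "\<dots> \<in> J"
  proof (rule ideal.subspace_sum[OF assms(1)])
    fix u assume "u \<in> Poly_Mapping.keys f"
    then have "Poly_Mapping.single 0 (Poly_Mapping.lookup f u) * mono_poly u \<in> J"
      using assms by (intro ideal.subspace_scale) auto
    then show "Poly_Mapping.single u (Poly_Mapping.lookup f u) \<in> J"
      by (simp add: mono_poly_def mult_single)
  qed
  finally show ?thesis .
qed

lemma subspace_keys_in:
  assumes "\<And>u w. u \<in> A \<Longrightarrow> u + w \<in> A"
  shows "ideal.subspace {f :: ('n, 'k::field) mpoly. Poly_Mapping.keys f \<subseteq> A}"
proof (rule ideal.subspaceI)
  fix x y c :: "('n, 'k) mpoly"
  show "x + y \<in> {f. Poly_Mapping.keys f \<subseteq> A}"
    if "x \<in> {f. Poly_Mapping.keys f \<subseteq> A}" "y \<in> {f. Poly_Mapping.keys f \<subseteq> A}"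
    using that Poly_Mapping.keys_add[of x y] by blast
  show "c * x \<in> {f. Poly_Mapping.keys f \<subseteq> A}" if "x \<in> {f. Poly_Mapping.keys f \<subseteq> A}"
  proof (clarify)
    fix u assume "u \<in> Poly_Mapping.keys (c * x)"
    then obtain a b where "u = b + a" "b \<in> Poly_Mapping.keys x"
      using keys_mult[of c x] by (auto simp: add.commute)
    with that assms show "u \<in> A" by blast
  qed
qed simp

lemma span_mono_poly_up_closed:
  assumes "\<And>u w. u \<in> A \<Longrightarrow> u + w \<in> A"
  shows "ideal.span (mono_poly ` A) = {f :: ('n, 'k::field) mpoly. Poly_Mapping.keys f \<subseteq> A}"
proof
  show "ideal.span (mono_poly ` A) \<subseteq> {f :: ('n, 'k) mpoly. Poly_Mapping.keys f \<subseteq> A}"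
    by (rule ideal.span_minimal[OF _ subspace_keys_in[OF assms]]) auto
  show "{f :: ('n, 'k) mpoly. Poly_Mapping.keys f \<subseteq> A} \<subseteq> ideal.span (mono_poly ` A)"
    by (rule subsetI, rule in_subspace_if_keys[OF ideal.subspace_span]) (auto intro: ideal.span_base)
qed

lemma monomial_ideal_subspace: "monomial_ideal I \<Longrightarrow> ideal.subspace I"
  by (auto simp: monomial_ideal_def ideal.subspace_span)

lemma monoms_up:
  assumes "monomial_ideal I" "u \<in> monoms I"
  shows "u + w \<in> monoms I"
  using ideal.subspace_scale[OF monomial_ideal_subspace[OF assms(1)], of "mono_poly u" "mono_poly w"]
    assms(2) by (simp add: monoms_def mono_poly_add mult.commute)

lemma monomial_ideal_eq:
  fixes I :: "('n, 'k::field) mpoly set"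
  assumes "monomial_ideal I"
  shows "I = {f. Poly_Mapping.keys f \<subseteq> monoms I}"
proof (intro equalityI subsetI)
  fix f assume f: "f \<in> I"
  obtain A where A: "I = ideal.span (mono_poly ` A)"
    using assms by (auto simp: monomial_ideal_def)
  have "u \<in> monoms I" if "u \<in> Poly_Mapping.keys f" for u
    using keys_span_mono_poly[of f A u] f that
    unfolding A monoms_def mem_Collect_eq mono_poly_in_span_iff by blast
  then show "f \<in> {f. Poly_Mapping.keys f \<subseteq> monoms I}" by blast
next
  fix f :: "('n, 'k) mpoly" assume "f \<in> {f. Poly_Mapping.keys f \<subseteq> monoms I}"
  then show "f \<in> I"
    by - (rule in_subspace_if_keys[OF monomial_ideal_subspace[OF assms]], auto simp: monoms_def)
qed

section \<open>Graded components and their minimal generators\<close>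

abbreviation layer :: "'n::finite monom set \<Rightarrow> nat \<Rightarrow> 'n monom set" where
  "layer U d \<equiv> {u \<in> U. total_deg u = d}"

lemma component_ideal_eq:
  fixes I :: "('n::finite, 'k::field) mpoly set"
  assumes "monomial_ideal I"
  shows "component_ideal I d = ideal.span (mono_poly ` layer (monoms I) d)"
  unfolding component_ideal_def
proof (rule equalityI; rule ideal.span_minimal[OF _ ideal.subspace_span]; rule subsetI)
  fix f assume "f \<in> component I d"
  then have "f \<in> I" and hom: "homogeneous_of_deg d f" by (auto simp: component_def)
  then have "Poly_Mapping.keys f \<subseteq> monoms I" using monomial_ideal_eq[OF assms] by blast
  with hom show "f \<in> ideal.span (mono_poly ` layer (monoms I) d)"
    by - (rule in_subspace_if_keys[OF ideal.subspace_span],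
        auto simp: homogeneous_of_deg_def intro!: ideal.span_base)
next
  fix f :: "('n, 'k) mpoly" assume "f \<in> mono_poly ` layer (monoms I) d"
  then show "f \<in> ideal.span (component I d)"
    by (auto simp: component_def homogeneous_of_deg_def monoms_def intro!: ideal.span_base)
qed

lemma monomial_ideal_span: "monomial_ideal (ideal.span (mono_poly ` A))"
  by (auto simp: monomial_ideal_def)

lemma monomial_ideal_component_ideal:
  "monomial_ideal I \<Longrightarrow> monomial_ideal (component_ideal I d)"
  unfolding component_ideal_eq by (rule monomial_ideal_span)

text \<open>Monomials of equal degree do not properly divide one another, so every monomial of
  degree \<open>d\<close> is a minimal generator.\<close>

lemma min_gens_component_ideal:
  fixes I :: "('n::finite, 'k::field) mpoly set"
  assumes "monomial_ideal I"
  shows "min_gens (component_ideal I d) = layer (monoms I) d"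
proof -
  let ?L = "layer (monoms I) d" and ?J = "component_ideal I d"
  have J: "?J = ideal.span (mono_poly ` ?L)" by (rule component_ideal_eq[OF assms])
  have mem: "mono_poly u \<in> ?J \<longleftrightarrow> (\<exists>v\<in>?L. \<exists>w. u = v + w)" for u
    unfolding J mono_poly_in_span_iff ..
  have "?L \<subseteq> divisor_minimal ?J"
  proof
    fix u assume u: "u \<in> ?L"
    have "w = 0" if vw: "u = v + w" "mono_poly v \<in> ?J" for v w
    proof -
      obtain v' w' where "v' \<in> ?L" "v = v' + w'" using vw(2) mem by blast
      with u vw(1) have "total_deg w = 0" by (simp add: total_deg_add)
      then show ?thesis by (simp add: total_deg_eq_0_iff)
    qed
    moreover have "mono_poly u \<in> ?J" unfolding J using u by (intro ideal.span_base) blast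
    ultimately show "u \<in> divisor_minimal ?J" by (auto simp: divisor_minimal_def)
  qed
  moreover have "divisor_minimal ?J \<subseteq> ?L"
    by (rule divisor_minimal_subset) (simp add: J)
  ultimately show ?thesis
    unfolding min_gens_eq[OF monomial_ideal_component_ideal[OF assms]] by (rule equalityI[rotated])
qed

lemma component_ideal_eq_0_iff:
  fixes I :: "('n::finite, 'k::field) mpoly set"
  assumes "monomial_ideal I"
  shows "component_ideal I d = {0} \<longleftrightarrow> layer (monoms I) d = {}"
proof
  assume zero: "component_ideal I d = {0}"
  have "mono_poly u \<noteq> (0 :: ('n, 'k) mpoly)" for u
    by (metis keys_mono_poly keys_zero insert_not_empty)
  moreover have "mono_poly u \<in> component_ideal I d" if "u \<in> layer (monoms I) d" for u
    unfolding component_ideal_eq[OF assms] using that by (intro ideal.span_base) blast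
  ultimately show "layer (monoms I) d = {}" using zero by blast
next
  assume "layer (monoms I) d = {}"
  then show "component_ideal I d = {0}"
    unfolding component_ideal_eq[OF assms] by (simp only: image_empty ideal.span_empty)
qed

lemma total_deg_var: "total_deg (var i) = 1"
  by (simp add: total_deg_def)

lemma componentwise_polymatroidal_iff:
  fixes I :: "('n::finite, 'k::field) mpoly set"
  shows "componentwise_polymatroidal I \<longleftrightarrow> monomial_ideal I \<and> layered (monoms I)"
proof (cases "monomial_ideal I")
  case True
  have comp: "polymatroidal (component_ideal I d) \<or> component_ideal I d = {0} \<longleftrightarrow>
      (\<forall>u\<in>layer (monoms I) d. \<forall>v\<in>layer (monoms I) d. \<forall>i. deg_in i u > deg_in i v \<longrightarrow>
        (\<exists>j. deg_in j u < deg_in j v \<and> var j + (u - var i) \<in> monoms I))" for d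
  proof -
    \<comment> \<open>An exchange preserves the degree, so belonging to the layer reduces to
      belonging to \<open>monoms I\<close>.\<close>
    have "total_deg (var j + (u - var i)) = total_deg u" if "0 < deg_in i u" for i j and u :: "'n monom"
    proof -
      have "var j + (u - var i) + var i = u + var j"
        using that by (intro monom_eqI) auto
      then have "total_deg (var j + (u - var i) + var i) = total_deg (u + var j)" by simp
      then show ?thesis by (simp add: total_deg_add total_deg_var)
    qed
    moreover have "monomial_ideal (component_ideal I d)"
      by (rule monomial_ideal_component_ideal[OF True])
    ultimately show ?thesis
      unfolding polymatroidal_def min_gens_component_ideal[OF True] component_ideal_eq_0_iff[OF True]
      by (auto; fastforce)
  qed
  show ?thesis
    unfolding componentwise_polymatroidal_def layered_def comp using True monoms_up[OF True] by auto
qed (simp add: componentwise_polymatroidal_def)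

section \<open>Powers of the maximal ideal and the saturation\<close>

lemma irrelevant_ideal_keys:
  assumes "f \<in> irrelevant_ideal" "u \<in> Poly_Mapping.keys f"
  shows "0 < total_deg u"
proof -
  have "f \<in> ideal.span (mono_poly ` range var)"
    using assms(1) by (simp add: irrelevant_ideal_def image_image)
  from keys_span_mono_poly[OF this assms(2)] obtain i w where "u = var i + w" by blast
  then show ?thesis
    by (simp add: total_deg_add total_deg_var)
qed

lemma ideal_pow_keys:
  fixes f :: "('n::finite, 'k::field) mpoly"
  assumes "f \<in> ideal_pow irrelevant_ideal k" "u \<in> Poly_Mapping.keys f"
  shows "k \<le> total_deg u"
  using assms
proof (induction k arbitrary: f u)
  case (Suc k)
  let ?A = "{u :: 'n monom. Suc k \<le> total_deg u}"
  have "ideal.subspace {f :: ('n, 'k) mpoly. Poly_Mapping.keys f \<subseteq> ?A}"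
    by (rule subspace_keys_in) (simp add: total_deg_add)
  moreover have "Poly_Mapping.keys (a * b) \<subseteq> ?A"
    if a: "a \<in> irrelevant_ideal" and b: "b \<in> ideal_pow irrelevant_ideal k" for a b :: "('n, 'k) mpoly"
  proof
    fix w assume "w \<in> Poly_Mapping.keys (a * b)"
    then obtain x y where "w = x + y" "x \<in> Poly_Mapping.keys a" "y \<in> Poly_Mapping.keys b"
      using keys_mult[of a b] by blast
    with irrelevant_ideal_keys[OF a] Suc.IH[OF b] show "w \<in> ?A"
      by (fastforce simp: total_deg_add)
  qed
  ultimately have "ideal_pow irrelevant_ideal (Suc k) \<subseteq> {f :: ('n, 'k) mpoly. Poly_Mapping.keys f \<subseteq> ?A}"
    unfolding ideal_pow.simps ideal_prod_def by (intro ideal.span_minimal) auto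
  with Suc.prems show ?case by blast
qed simp

lemma var_power_in_ideal_pow:
  "mono_poly (Poly_Mapping.single i k) \<in> ideal_pow (irrelevant_ideal :: ('n::finite, 'k::field) mpoly set) k"
proof (induction k)
  case (Suc k)
  have "mono_poly (var i) \<in> (irrelevant_ideal :: ('n, 'k) mpoly set)"
    unfolding irrelevant_ideal_def by (intro ideal.span_base) blast
  moreover have "Poly_Mapping.single i (Suc k) = var i + Poly_Mapping.single i k"
    by (simp add: var_def flip: single_add)
  ultimately show ?case
    using Suc unfolding ideal_pow.simps ideal_prod_def
    by (intro ideal.span_base) (auto simp: mono_poly_add)
qed simp

text \<open>Multiplying by a monomial shifts exponents injectively, so no terms cancel.\<close>

lemma keys_times_mono_poly:
  fixes f :: "('n, 'k::field) mpoly"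
  assumes "u \<in> Poly_Mapping.keys f"
  shows "u + w \<in> Poly_Mapping.keys (f * mono_poly w)"
proof -
  have "Poly_Mapping.lookup (f * mono_poly w) (u + w) =
      (\<Sum>v\<in>Poly_Mapping.keys f. Poly_Mapping.lookup f v when v + w = u + w)"
    by (subst (1) eq_sum_single[of f])
      (simp add: mono_poly_def sum_distrib_right mult_single lookup_sum lookup_single)
  also have "\<dots> = Poly_Mapping.lookup f u"
    using assms by (simp add: when_def)
  finally have "Poly_Mapping.lookup (f * mono_poly w) (u + w) = Poly_Mapping.lookup f u" .
  then show ?thesis using assms by (simp add: in_keys_iff)
qed

text \<open>One inclusion tests against the pure powers in
  \<open>ideal_pow irrelevant_ideal k\<close>; the other uses that a monomial of large degree has a
  large exponent in some variable.\<close>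

lemma saturation_eq:
  fixes I :: "('n::finite, 'k::field) mpoly set"
  assumes I: "monomial_ideal I" and "layered (monoms I)"
  shows "saturation I = {f. Poly_Mapping.keys f \<subseteq> layered.sat (monoms I)}"
proof (intro equalityI subsetI)
  interpret layered "monoms I" by fact
  fix f assume "f \<in> saturation I"
  then obtain k where k: "\<And>g. g \<in> ideal_pow irrelevant_ideal k \<Longrightarrow> f * g \<in> I"
    by (auto simp: saturation_def colon_ideal_def)
  have "u \<in> loc i" if u: "u \<in> Poly_Mapping.keys f" for u i
  proof -
    let ?w = "Poly_Mapping.single i k"
    have "Poly_Mapping.keys (f * mono_poly ?w) \<subseteq> monoms I"
      using k[OF var_power_in_ideal_pow] monomial_ideal_eq[OF I] by blast
    then show ?thesis using keys_times_mono_poly[OF u, of ?w] by (auto simp: loc_def)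
  qed
  then show "f \<in> {f. Poly_Mapping.keys f \<subseteq> sat}" by (auto simp: sat_def)
next
  interpret layered "monoms I" by fact
  fix f :: "('n, 'k) mpoly" assume "f \<in> {f. Poly_Mapping.keys f \<subseteq> sat}"
  then have "\<forall>u\<in>Poly_Mapping.keys f. \<forall>i. \<exists>N. u + Poly_Mapping.single i N \<in> monoms I"
    by (auto simp: sat_def loc_def)
  then obtain N where N: "\<And>u i. u \<in> Poly_Mapping.keys f \<Longrightarrow> u + Poly_Mapping.single i (N u i) \<in> monoms I"
    by metis
  \<comment> \<open>A crude common bound: the sum of the finitely many exponents
    \<open>N u i\<close>.\<close>
  define M where "M = (\<Sum>u\<in>Poly_Mapping.keys f. \<Sum>i\<in>UNIV. N u i)"
  have N_le: "N u i \<le> M" if "u \<in> Poly_Mapping.keys f" for u i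
  proof -
    have "N u i \<le> (\<Sum>i\<in>UNIV. N u i)" by (rule member_le_sum) auto
    also have "\<dots> \<le> M" unfolding M_def using that
      by (intro member_le_sum[where f = "\<lambda>u. \<Sum>i\<in>UNIV. N u i"]) auto
    finally show ?thesis .
  qed
  have "f * g \<in> I" if g: "g \<in> ideal_pow irrelevant_ideal (card (UNIV :: 'n set) * M)" for g
  proof -
    have "w \<in> monoms I" if w: "w \<in> Poly_Mapping.keys (f * g)" for w
    proof -
      obtain u v where uv: "w = u + v" "u \<in> Poly_Mapping.keys f" "v \<in> Poly_Mapping.keys g"
        using w keys_mult[of f g] by blast
      \<comment> \<open>Pigeonhole: the degree of \<open>v\<close> is at least the number of
        variables times \<open>M\<close>.\<close>
      obtain i where i: "M \<le> deg_in i v"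
      proof (rule ccontr)
        assume "\<not> thesis"
        then have "\<And>i. deg_in i v < M" using that by (meson not_le)
        then have "total_deg v < (\<Sum>i\<in>(UNIV :: 'n set). M)"
          unfolding total_deg_def by (intro sum_strict_mono) auto
        with ideal_pow_keys[OF g uv(3)] show False by simp
      qed
      let ?s = "Poly_Mapping.single i (N u i)"
      have "w = (u + ?s) + (v - ?s)"
        unfolding uv(1) using i N_le[OF uv(2), of i] by (intro monom_eqI) auto
      with monoms_up[OF I N[OF uv(2)]] show ?thesis by metis
    qed
    then show ?thesis using monomial_ideal_eq[OF I] by blast
  qed
  then show "f \<in> saturation I" by (auto simp: saturation_def colon_ideal_def)
qed

theorem corollary9p2:
  fixes I :: "('n::finite, 'k::field) mpoly set"
  assumes "componentwise_polymatroidal I"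
  shows "componentwise_polymatroidal (saturation I)"
proof -
  from assms have I: "monomial_ideal I" and lay: "layered (monoms I)"
    by (simp_all add: componentwise_polymatroidal_iff)
  interpret layered "monoms I" by fact
  have sat_up: "u + w \<in> sat" if "u \<in> sat" for u w
    using that loc_up by (auto simp: sat_def)
  have eq: "saturation I = {f. Poly_Mapping.keys f \<subseteq> sat}"
    by (rule saturation_eq[OF I lay])
  also have "\<dots> = ideal.span (mono_poly ` sat)"
    using span_mono_poly_up_closed[of sat] sat_up by blast
  finally have "monomial_ideal (saturation I)"
    by (auto simp: monomial_ideal_def)
  moreover have "monoms (saturation I) = sat"
    unfolding eq by (simp add: monoms_def)
  moreover have "layered sat"
    using sat_up sat_exchange by unfold_locales
  ultimately show ?thesis by (simp add: componentwise_polymatroidal_iff)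
qed

end
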